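(* Let $n\geq 1$ be an integer, $\lambda_n=n^2$, and $\mu\neq 0$ a constant. Consider the Chebyshev differential equation $$y''-\frac{x}{1-x^2}\,y'+\frac{\lambda_n}{1-x^2}\,y=0.$$ The following statements are true. (1) The differential Galois group $G(L/K)$ of this equation over $K=\mathbb{C}(x)$ is isomorphic to $\mathbb{Z}_2$. (2) First integrals of the polynomial systems associated with the Chebyshev equation, $$\begin{cases}\dot w=-2-4\lambda_n+(4\lambda_n-1)x^2-4(1-x^2)^2w^2,\\ \dot x=4(1-x^2)^2\end{cases}$$ and $$\begin{cases}\dot v=\dfrac{\lambda_n}{\mu}(1-x^2)-xv+\mu v^2,\\ \dot x=1-x^2,\end{cases}$$ are, respectively, $$I(w,x)=\frac{-w+\dfrac{U_{n-1}'}{U_{n-1}}-\dfrac{3x}{2(1-x^2)}}{-w+\dfrac{T_n'}{T_n}-\dfrac{x}{2(1-x^2)}}\cdot\frac{U_{n-1}}{T_n}\sqrt{1-x^2}$$ and $$I(v,x)=\frac{U_{n-1}'(1-x^2)+U_{n-1}(\mu v-x)}{T_n'(1-x^2)+\mu T_n v}\cdot\sqrt{1-x^2}.$$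
   Context: $T_n=T_n(x)$ and $U_n=U_n(x)$ denote the Chebyshev polynomials of the first and second kind of degree $n$, i.e. $T_n(\cos\theta)=\cos n\theta$ and $U_n(\cos\theta)=\sin((n+1)\theta)/\sin\theta$; primes denote derivatives with respect to $x$. $K=\mathbb{C}(x)$ is the differential field of rational functions with derivation $d/dx$, $L$ is the Picard–Vessiot extension of $K$ for the Chebyshev equation, and $G(L/K)$ is the group of differential automorphisms of $L$ fixing $K$ pointwise. Systems are considered over $\mathbb{C}$. A first integral of a planar system is a non-constant function (possibly multivalued, understood via local analytic branches where it is defined) that is constant along the solutions of the system, i.e. it is annihilated by the associated vector field. *)

theory Defs
  imports
    "HOL-Complex_Analysis.Complex_Analysis"
    "HOL-Computational_Algebra.Computational_Algebra"
    "HOL-Algebra.Elementary_Groups"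
begin

section \<open>Chebyshev polynomials\<close>

definition cheb_T :: "nat \<Rightarrow> complex poly" where
  "cheb_T n = (THE p. \<forall>\<theta>. poly p (cos \<theta>) = cos (of_nat n * \<theta>))"

definition cheb_U :: "nat \<Rightarrow> complex poly" where
  "cheb_U n = (THE p. \<forall>\<theta>. sin \<theta> \<noteq> 0 \<longrightarrow>
      poly p (cos \<theta>) = sin (of_nat (n + 1) * \<theta>) / sin \<theta>)"

text \<open>Both descriptions determine exactly one polynomial.\<close>

lemma cheb_T_exists: "\<exists>p. \<forall>\<theta>::complex. poly p (cos \<theta>) = cos (of_nat n * \<theta>)"
proof (induction n rule: induct_nat_012)
  case 0
  show ?case by (rule exI[of _ 1]) simp
next
  case 1
  show ?case by (rule exI[of _ "[:0, 1:]"]) simp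
next
  case (ge2 n)
  then obtain p q where p: "\<And>\<theta>::complex. poly p (cos \<theta>) = cos (of_nat n * \<theta>)"
    and q: "\<And>\<theta>::complex. poly q (cos \<theta>) = cos (of_nat (Suc n) * \<theta>)" by blast
  have "poly ([:0, 2:] * q - p) (cos \<theta>) = cos (of_nat (Suc (Suc n)) * \<theta>)" for \<theta> :: complex
  proof -
    have "cos (of_nat (Suc (Suc n)) * \<theta>) = cos (of_nat (Suc n) * \<theta> + \<theta>)"
      and "cos (of_nat n * \<theta>) = cos (of_nat (Suc n) * \<theta> - \<theta>)"
      by (simp_all add: algebra_simps)
    then show ?thesis
      by (simp add: p q cos_add cos_diff del: of_nat_Suc)
  qed
  then show ?case by blast
qed

lemma cheb_U_exists:
  "\<exists>p. \<forall>\<theta>::complex. sin \<theta> \<noteq> 0 \<longrightarrow>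
      poly p (cos \<theta>) = sin (of_nat (n + 1) * \<theta>) / sin \<theta>"
proof -
  have "\<exists>p. \<forall>\<theta>::complex. poly p (cos \<theta>) * sin \<theta> = sin (of_nat (n + 1) * \<theta>)"
  proof (induction n rule: induct_nat_012)
    case 0
    show ?case by (rule exI[of _ 1]) simp
  next
    case 1
    have "sin (2 * \<theta>) = 2 * sin \<theta> * cos \<theta>" for \<theta> :: complex
      by (rule sin_double)
    then show ?case by (intro exI[of _ "[:0, 2:]"]) simp
  next
    case (ge2 n)
    then obtain p q where p: "\<And>\<theta>::complex. poly p (cos \<theta>) * sin \<theta> = sin (of_nat (n + 1) * \<theta>)"
      and q: "\<And>\<theta>::complex. poly q (cos \<theta>) * sin \<theta> = sin (of_nat (Suc n + 1) * \<theta>)" by blast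
    have "poly ([:0, 2:] * q - p) (cos \<theta>) * sin \<theta> = sin (of_nat (Suc (Suc n) + 1) * \<theta>)"
      for \<theta> :: complex
    proof -
      have "sin (of_nat (Suc (Suc n) + 1) * \<theta>) = sin (of_nat (Suc n + 1) * \<theta> + \<theta>)"
        and "sin (of_nat (n + 1) * \<theta>) = sin (of_nat (Suc n + 1) * \<theta> - \<theta>)"
        by (simp_all add: algebra_simps)
      moreover have "poly ([:0, 2:] * q - p) (cos \<theta>) * sin \<theta>
          = 2 * cos \<theta> * (poly q (cos \<theta>) * sin \<theta>) - poly p (cos \<theta>) * sin \<theta>"
        by (simp add: algebra_simps)
      ultimately show ?thesis
        unfolding p q by (simp add: sin_add sin_diff del: of_nat_Suc of_nat_add)
    qed
    then show ?case by blast
  qed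
  then obtain p where p: "\<And>\<theta>::complex. poly p (cos \<theta>) * sin \<theta> = sin (of_nat (n + 1) * \<theta>)"
    by blast
  have "poly p (cos \<theta>) = sin (of_nat (n + 1) * \<theta>) / sin \<theta>" if "sin \<theta> \<noteq> 0" for \<theta>
    using that p[of \<theta>, symmetric] by simp
  then show ?thesis by blast
qed

lemma cheb_T_cos: "poly (cheb_T n) (cos \<theta>) = cos (of_nat n * \<theta>)"
proof -
  have "\<exists>!p. \<forall>\<theta>::complex. poly p (cos \<theta>) = cos (of_nat n * \<theta>)"
  proof (rule ex_ex1I[OF cheb_T_exists])
    fix p q :: "complex poly"
    assume "\<forall>\<theta>. poly p (cos \<theta>) = cos (of_nat n * \<theta>)"
      and "\<forall>\<theta>. poly q (cos \<theta>) = cos (of_nat n * \<theta>)"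
    then have "poly p (cos (Arccos z)) = poly q (cos (Arccos z))" for z by presburger
    then have "poly p z = poly q z" for z by (simp only: cos_Arccos)
    then show "p = q" by (simp add: poly_eq_poly_eq_iff[symmetric] fun_eq_iff)
  qed
  from theI'[OF this] show ?thesis unfolding cheb_T_def by blast
qed

lemma cheb_U_cos:
  assumes "sin \<theta> \<noteq> 0"
  shows "poly (cheb_U n) (cos \<theta>) = sin (of_nat (n + 1) * \<theta>) / sin \<theta>"
proof -
  have "\<exists>!p. \<forall>\<theta>::complex. sin \<theta> \<noteq> 0 \<longrightarrow>
      poly p (cos \<theta>) = sin (of_nat (n + 1) * \<theta>) / sin \<theta>"
  proof (rule ex_ex1I[OF cheb_U_exists])
    fix p q :: "complex poly"
    assume p: "\<forall>\<theta>. sin \<theta> \<noteq> 0 \<longrightarrow> poly p (cos \<theta>) = sin (of_nat (n + 1) * \<theta>) / sin \<theta>"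
      and q: "\<forall>\<theta>. sin \<theta> \<noteq> 0 \<longrightarrow> poly q (cos \<theta>) = sin (of_nat (n + 1) * \<theta>) / sin \<theta>"
    have "poly ((p - q) * [:1, 0, -1:]) z = 0" for z
    proof (cases "sin (Arccos z) = 0")
      case True
      then have "z\<^sup>2 = 1" using sin_cos_squared_add[of "Arccos z"] by simp
      then have "poly [:1, 0, -1:] z = 0" by (simp add: power2_eq_square)
      then show ?thesis by (simp only: poly_mult mult_zero_right)
    next
      case False
      then have "poly p (cos (Arccos z)) = poly q (cos (Arccos z))" using p q by metis
      then have "poly p z = poly q z" by (simp only: cos_Arccos)
      then show ?thesis by simp
    qed
    then have "(p - q) * [:1, 0, -1:] = 0" by (simp only: poly_all_0_iff_0[symmetric]) simp
    then have "p - q = 0 \<or> [:1, 0, -1 :: complex:] = 0" by (simp only: mult_eq_0_iff)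
    then show "p = q" by simp
  qed
  from theI'[OF this] show ?thesis using assms unfolding cheb_U_def by blast
qed


section \<open>The differential field of rational functions\<close>

definition fract_deriv :: "'a::field poly fract \<Rightarrow> 'a poly fract" where
  "fract_deriv f = (THE g. \<exists>a b. b \<noteq> 0 \<and> f = Fract a b \<and>
     g = Fract (pderiv a * b - a * pderiv b) (b\<^sup>2))"

lemma fract_deriv_Fract:
  fixes a b :: "'a::field poly"
  assumes b: "b \<noteq> 0"
  shows "fract_deriv (Fract a b) = Fract (pderiv a * b - a * pderiv b) (b\<^sup>2)"
  unfolding fract_deriv_def
proof (rule the_equality)
  show "\<exists>c d. d \<noteq> 0 \<and> Fract a b = Fract c d \<and>
      Fract (pderiv a * b - a * pderiv b) (b\<^sup>2) = Fract (pderiv c * d - c * pderiv d) (d\<^sup>2)"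
    using b by blast
next
  fix g assume "\<exists>c d. d \<noteq> 0 \<and> Fract a b = Fract c d \<and> g = Fract (pderiv c * d - c * pderiv d) (d\<^sup>2)"
  then obtain c d where d: "d \<noteq> 0" and ab: "Fract a b = Fract c d"
    and g: "g = Fract (pderiv c * d - c * pderiv d) (d\<^sup>2)" by blast
  have eq: "a * d = c * b" using ab b d by (simp add: eq_fract)
  have "pderiv (a * d) = pderiv (c * b)" by (simp only: eq)
  then have d_eq: "a * pderiv d + d * pderiv a = c * pderiv b + b * pderiv c"
    by (simp add: pderiv_mult)
  have "(pderiv a * b - a * pderiv b) * d\<^sup>2 - (pderiv c * d - c * pderiv d) * b\<^sup>2
      = b * d * (d * pderiv a - b * pderiv c) - d * pderiv b * (a * d) + b * pderiv d * (c * b)"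
    by (simp add: algebra_simps power2_eq_square)
  also have "\<dots> = b * d * (d * pderiv a - b * pderiv c) - d * pderiv b * (c * b) + b * pderiv d * (a * d)"
    by (simp only: eq)
  also have "\<dots> = b * d * ((a * pderiv d + d * pderiv a) - (c * pderiv b + b * pderiv c))"
    by (simp add: algebra_simps)
  finally show "g = Fract (pderiv a * b - a * pderiv b) (b\<^sup>2)"
    using b d by (simp add: g d_eq eq_fract)
qed


section \<open>Differential fields and Picard--Vessiot extensions\<close>

definition is_derivation :: "('a::field \<Rightarrow> 'a) \<Rightarrow> bool" where
  "is_derivation D \<longleftrightarrow>
     (\<forall>a b. D (a + b) = D a + D b) \<and> (\<forall>a b. D (a * b) = D a * b + a * D b)"

lemma is_derivation_fract_deriv: "is_derivation (fract_deriv :: 'a::field poly fract \<Rightarrow> _)"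
  unfolding is_derivation_def
proof safe
  fix f g :: "'a poly fract"
  obtain a b where f: "f = Fract a b" "b \<noteq> 0" by (cases f)
  obtain c d where g: "g = Fract c d" "d \<noteq> 0" by (cases g)
  show "fract_deriv (f + g) = fract_deriv f + fract_deriv g"
    using f(2) g(2) unfolding f(1) g(1)
    by (simp add: fract_deriv_Fract eq_fract pderiv_mult pderiv_add algebra_simps power2_eq_square)
  show "fract_deriv (f * g) = fract_deriv f * g + f * fract_deriv g"
    using f(2) g(2) unfolding f(1) g(1)
    by (simp add: fract_deriv_Fract eq_fract pderiv_mult algebra_simps power2_eq_square)
qed

definition consts_of :: "('a::field \<Rightarrow> 'a) \<Rightarrow> 'a set" where
  "consts_of D = {c. D c = 0}"

definition is_field_hom :: "('a::field \<Rightarrow> 'b::field) \<Rightarrow> bool" where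
  "is_field_hom f \<longleftrightarrow> f 1 = 1 \<and> (\<forall>a b. f (a + b) = f a + f b) \<and> (\<forall>a b. f (a * b) = f a * f b)"

text \<open>A differential field extension is a differential field \<open>(L, D)\<close> with a homomorphism
  \<open>\<iota>\<close> from the differential base field \<open>(K, d)\<close>, which is identified with its image.\<close>

definition diff_field_ext ::
    "('k::field \<Rightarrow> 'k) \<Rightarrow> ('l::field \<Rightarrow> 'l) \<Rightarrow> ('k \<Rightarrow> 'l) \<Rightarrow> bool" where
  "diff_field_ext d D \<iota> \<longleftrightarrow>
     is_derivation d \<and> is_derivation D \<and> is_field_hom \<iota> \<and> (\<forall>a. D (\<iota> a) = \<iota> (d a))"

definition diff_subfield :: "('l::field \<Rightarrow> 'l) \<Rightarrow> 'l set \<Rightarrow> bool" where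
  "diff_subfield D F \<longleftrightarrow> 1 \<in> F \<and> (\<forall>a\<in>F. \<forall>b\<in>F. a - b \<in> F \<and> a * b \<in> F) \<and>
     (\<forall>a\<in>F. inverse a \<in> F) \<and> (\<forall>a\<in>F. D a \<in> F)"

text \<open>\<open>L\<close> is a Picard--Vessiot extension of \<open>K\<close> for \<open>y'' + p y' + q y = 0\<close>: it has no new
  constants and is generated, as a differential field over \<open>K\<close>, by two solutions that are
  linearly independent over the constants.\<close>

definition picard_vessiot ::
    "('k::field \<Rightarrow> 'k) \<Rightarrow> ('l::field \<Rightarrow> 'l) \<Rightarrow> ('k \<Rightarrow> 'l) \<Rightarrow> 'k \<Rightarrow> 'k \<Rightarrow> bool" where
  "picard_vessiot d D \<iota> p q \<longleftrightarrow>
     diff_field_ext d D \<iota> \<and>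
     consts_of D = \<iota> ` consts_of d \<and>
     (\<exists>y1 y2.
        (\<forall>y\<in>{y1, y2}. D (D y) + \<iota> p * D y + \<iota> q * y = 0) \<and>
        (\<forall>c1\<in>consts_of D. \<forall>c2\<in>consts_of D. c1 * y1 + c2 * y2 = 0 \<longrightarrow> c1 = 0 \<and> c2 = 0) \<and>
        (\<forall>F. diff_subfield D F \<and> range \<iota> \<subseteq> F \<and> {y1, y2} \<subseteq> F \<longrightarrow> F = UNIV))"

definition diff_galois_group :: "('l::field \<Rightarrow> 'l) \<Rightarrow> ('k::field \<Rightarrow> 'l) \<Rightarrow> ('l \<Rightarrow> 'l) monoid" where
  "diff_galois_group D \<iota> =
     \<lparr>carrier = {\<sigma>. bij \<sigma> \<and> is_field_hom \<sigma> \<and> (\<forall>a. \<sigma> (D a) = D (\<sigma> a)) \<and> (\<forall>k. \<sigma> (\<iota> k) = \<iota> k)},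
      monoid.mult = (\<circ>), one = id\<rparr>"

lemma group_diff_galois_group: "group (diff_galois_group D \<iota>)"
proof (rule groupI)
  fix \<sigma> assume \<sigma>: "\<sigma> \<in> carrier (diff_galois_group D \<iota>)"
  then have b: "bij \<sigma>" by (simp add: diff_galois_group_def)
  then have i: "\<sigma> (inv_into UNIV \<sigma> a) = a" for a by (simp add: bij_is_surj surj_f_inv_f)
  have e: "inv_into UNIV \<sigma> c = a \<longleftrightarrow> c = \<sigma> a" for a c using b i by (metis bij_inv_eq_iff)
  have "inv_into UNIV \<sigma> \<in> carrier (diff_galois_group D \<iota>)"
    using \<sigma> b i by (auto simp: diff_galois_group_def is_field_hom_def bij_imp_bij_inv e)
  moreover have "inv_into UNIV \<sigma> \<circ> \<sigma> = id" using b by (simp add: bij_is_inj)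
  ultimately show "\<exists>\<tau>\<in>carrier (diff_galois_group D \<iota>).
      \<tau> \<otimes>\<^bsub>diff_galois_group D \<iota>\<^esub> \<sigma> = \<one>\<^bsub>diff_galois_group D \<iota>\<^esub>"
    by (intro bexI[of _ "inv_into UNIV \<sigma>"]) (simp_all add: diff_galois_group_def)
qed (auto simp: diff_galois_group_def is_field_hom_def bij_comp comp_assoc)


section \<open>First integrals of planar systems over the complex numbers\<close>

text \<open>A (single-valued, analytic) function \<open>f\<close> on an open set \<open>\<Omega>\<close> in two complex variables
  is a first integral of the vector field \<open>X\<close>. Analyticity in two complex variables is
  complex Frechet differentiability on an open set, the numbers \<open>a\<close>, \<open>b\<close> being the two partial
  derivatives. Since \<open>\<Omega>\<close> need not be connected, \<open>f\<close> is required to be non-constant on every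
  nonempty open part of it.\<close>

definition first_integral_on ::
    "(complex \<times> complex \<Rightarrow> complex \<times> complex) \<Rightarrow> (complex \<times> complex \<Rightarrow> complex) \<Rightarrow>
     (complex \<times> complex) set \<Rightarrow> bool" where
  "first_integral_on X f \<Omega> \<longleftrightarrow>
     open \<Omega> \<and> \<Omega> \<noteq> {} \<and>
     (\<forall>z\<in>\<Omega>. \<exists>a b. (f has_derivative (\<lambda>(h, k). a * h + b * k)) (at z) \<and>
        a * fst (X z) + b * snd (X z) = 0) \<and>
     (\<forall>V. open V \<and> V \<noteq> {} \<and> V \<subseteq> \<Omega> \<longrightarrow> \<not> f constant_on V)"

text \<open>The local analytic branches of the multivalued function \<open>sqrt (1 - x\<^sup>2)\<close>; there is one
  around every point other than \<open>1\<close> and \<open>-1\<close>.\<close>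

definition sqrt_branch :: "complex set \<Rightarrow> (complex \<Rightarrow> complex) \<Rightarrow> bool" where
  "sqrt_branch S s \<longleftrightarrow>
     open S \<and> S \<noteq> {} \<and> s holomorphic_on S \<and> (\<forall>x\<in>S. (s x)\<^sup>2 = 1 - x\<^sup>2)"

lemma sqrt_branch_exists:
  assumes "x0\<^sup>2 \<noteq> 1"
  shows "\<exists>S s. x0 \<in> S \<and> sqrt_branch S s"
proof -
  define c where "c = 1 - x0\<^sup>2"
  have c: "c \<noteq> 0" using assms by (simp add: c_def)
  define S where "S = (\<lambda>x. (1 - x\<^sup>2) / c) -` (- \<real>\<^sub>\<le>\<^sub>0)"
  have "open S"
    unfolding S_def using c
    by (intro open_vimage open_Compl closed_nonpos_Reals_complex continuous_intros) auto
  moreover have "x0 \<in> S" using c by (simp add: S_def c_def)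
  moreover have "(\<lambda>x. csqrt c * csqrt ((1 - x\<^sup>2) / c)) holomorphic_on S"
    by (intro holomorphic_intros) (auto simp: S_def c)
  moreover have "(csqrt c * csqrt ((1 - x\<^sup>2) / c))\<^sup>2 = 1 - x\<^sup>2" for x
    using c by (simp add: power_mult_distrib)
  ultimately show ?thesis unfolding sqrt_branch_def by blast
qed

end

theory Submission
  imports Defs "HOL-Computational_Algebra.Field_as_Ring"
begin

text \<open>Write \<open>R = 1 - x\<^sup>2\<close>, \<open>T = T\<^sub>n\<close> and \<open>U = U\<^bsub>n-1\<^esub>\<close>. The solutions of the equation are
  \<open>T\<close> and \<open>\<surd>R U\<close>, with Wronskian a constant multiple of \<open>\<surd>R / R\<close>.

  The square of any nonzero Wronskian \<open>W\<close> of \<open>T\<close> with another solution is a constant times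
  \<open>1 / R\<close>, and every constant is a square; so a Picard--Vessiot extension contains a square root
  \<open>s\<close> of \<open>R\<close>, hence all solutions lie in \<open>K + K s\<close>. As \<open>R\<close> is not a square in \<open>K\<close>, the extension
  is quadratic and the only nontrivial automorphism is \<open>s \<mapsto> - s\<close>.

  Both systems are Riccati equations obtained from the linear equation by a substitution
  expressing \<open>w\<close> or \<open>v\<close> through \<open>y' / y\<close>. Each solution \<open>y\<close> gives a Darboux function which is linear in
  the dependent variable, with a cofactor that does not depend on \<open>y\<close>, so the quotient of the
  functions belonging to \<open>\<surd>R U\<close> and \<open>T\<close> is a first integral.\<close>

section \<open>Relations between the Chebyshev polynomials\<close>

text \<open>The cosine is surjective and \<open>sin \<theta> = 0\<close> forces
  \<open>cos \<theta>\<close> to be 1 or -1, so \<open>p - q\<close> vanishes off two points and has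
  infinitely many roots. Zeros of the sine are left out because \<open>cheb_U\<close> is specified
  only away from them.\<close>

lemma poly_eqI_cos:
  fixes p q :: "complex poly"
  assumes "\<And>\<theta>. sin \<theta> \<noteq> 0 \<Longrightarrow> poly p (cos \<theta>) = poly q (cos \<theta>)"
  shows "p = q"
proof (rule ccontr)
  assume "p \<noteq> q"
  then have "finite {z. poly (p - q) z = 0}"
    by (intro poly_roots_finite) simp
  moreover have "- {1, -1} \<subseteq> {z. poly (p - q) z = 0}"
  proof
    fix z :: complex assume z: "z \<in> - {1, -1}"
    have "sin (Arccos z) \<noteq> 0"
    proof
      assume "sin (Arccos z) = 0"
      then have "z\<^sup>2 = 1" using sin_cos_squared_add[of "Arccos z"] by simp
      with z show False by (simp add: power2_eq_1_iff)
    qed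
    from assms[OF this] show "z \<in> {z. poly (p - q) z = 0}" by simp
  qed
  ultimately have "finite (- {1, -1 :: complex})" using finite_subset by blast
  then have "finite (UNIV :: complex set)" by (metis finite_compl finite.emptyI finite_insert)
  then show False by (simp add: infinite_UNIV_char_0)
qed

text \<open>Differentiate the defining identity with respect to \<open>\<theta>\<close> and cancel
  the factor \<open>- sin \<theta>\<close> from the chain rule.\<close>

lemma pderiv_cheb_T: "pderiv (cheb_T (Suc m)) = smult (of_nat (Suc m)) (cheb_U m)"
proof (rule poly_eqI_cos)
  fix \<theta> :: complex assume \<theta>: "sin \<theta> \<noteq> 0"
  let ?n = "of_nat (Suc m) :: complex"
  have "((\<lambda>\<theta>. poly (cheb_T (Suc m)) (cos \<theta>)) has_field_derivative
      poly (pderiv (cheb_T (Suc m))) (cos \<theta>) * (- sin \<theta>)) (at \<theta>)"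
    using DERIV_chain2[OF poly_DERIV DERIV_cos] by blast
  moreover have "((\<lambda>\<theta>. cos (?n * \<theta>)) has_field_derivative - sin (?n * \<theta>) * ?n) (at \<theta>)"
    by (auto intro!: derivative_eq_intros simp del: of_nat_Suc)
  ultimately have "poly (pderiv (cheb_T (Suc m))) (cos \<theta>) * (- sin \<theta>) = - sin (?n * \<theta>) * ?n"
    unfolding cheb_T_cos using DERIV_unique by blast
  with \<theta> show "poly (pderiv (cheb_T (Suc m))) (cos \<theta>) = poly (smult ?n (cheb_U m)) (cos \<theta>)"
    by (simp add: cheb_U_cos field_simps del: of_nat_Suc)
qed

text \<open>Differentiating this Pell equation gives the relation for the derivative of \<open>U\<close> below.\<close>

lemma cheb_pell: "(cheb_T (Suc m))\<^sup>2 + [:1, 0, -1:] * (cheb_U m)\<^sup>2 = 1"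
proof (rule poly_eqI_cos)
  fix \<theta> :: complex assume \<theta>: "sin \<theta> \<noteq> 0"
  have "1 - (cos \<theta>)\<^sup>2 = (sin \<theta>)\<^sup>2" by (simp add: sin_squared_eq)
  then have "poly [:1, 0, -1:] (cos \<theta>) = (sin \<theta>)\<^sup>2" by (simp add: power2_eq_square)
  with \<theta> show "poly ((cheb_T (Suc m))\<^sup>2 + [:1, 0, -1:] * (cheb_U m)\<^sup>2) (cos \<theta>) = poly 1 (cos \<theta>)"
    by (simp add: cheb_U_cos cheb_T_cos power_divide del: of_nat_Suc poly_pCons mult_pCons_left)
qed

text \<open>Otherwise the Pell equation would make the square of \<open>cheb_T (Suc m)\<close> equal
  to 1, but this polynomial vanishes at the cosine of pi / (2 (m + 1)).\<close>

lemma cheb_U_nonzero: "cheb_U m \<noteq> 0"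
proof
  assume "cheb_U m = 0"
  with cheb_pell[of m] have "poly ((cheb_T (Suc m))\<^sup>2) (cos (of_real pi / (2 * of_nat (Suc m)))) = 1"
    by simp
  moreover have "of_nat (Suc m) * (of_real pi / (2 * of_nat (Suc m))) = (of_real pi / 2 :: complex)"
    by (simp add: field_simps del: of_nat_Suc)
  ultimately show False
    by (simp add: cheb_T_cos del: of_nat_Suc)
qed

lemma cheb_T_nonzero: "cheb_T n \<noteq> 0"
  using cheb_T_cos[of n 0] by auto

lemma pderiv_cheb_U:
  "[:1, 0, -1:] * pderiv (cheb_U m) = [:0, 1:] * cheb_U m - smult (of_nat (Suc m)) (cheb_T (Suc m))"
proof -
  let ?U = "cheb_U m" and ?T = "cheb_T (Suc m)" and ?n = "of_nat (Suc m) :: complex"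
  have "pderiv (?T\<^sup>2 + [:1, 0, -1:] * ?U\<^sup>2) = 0" by (simp only: cheb_pell pderiv_1)
  \<comment> \<open>Replacing T' by n U makes every term divisible by 2 U; cancelling this nonzero
    factor leaves the claim.\<close>
  moreover have "pderiv (?T\<^sup>2 + [:1, 0, -1:] * ?U\<^sup>2)
      = smult 2 ?U * ([:1, 0, -1:] * pderiv ?U - ([:0, 1:] * ?U - smult ?n ?T))"
    by (rule poly_ext, simp add: pderiv_add pderiv_minus pderiv_mult power2_eq_square pderiv_cheb_T pderiv_pCons del: of_nat_Suc)
      (simp add: algebra_simps)
  ultimately show ?thesis using cheb_U_nonzero[of m] by simp
qed

section \<open>First integrals\<close>

text \<open>A function constant on an open set has derivative zero there. By uniqueness of the
  derivative its value \<open>a\<close> in direction (1, 0) would vanish, so a nonzero first partial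
  derivative at every point excludes local constancy.\<close>

lemma first_integral_onI:
  assumes "open \<Omega>" and "\<Omega> \<noteq> {}"
    and ex: "\<And>z. z \<in> \<Omega> \<Longrightarrow> \<exists>a b. (f has_derivative (\<lambda>(h, k). a * h + b * k)) (at z) \<and>
        a * fst (X z) + b * snd (X z) = 0 \<and> a \<noteq> 0"
  shows "first_integral_on X f \<Omega>"
proof -
  have "\<not> f constant_on V" if V: "open V" "V \<noteq> {}" "V \<subseteq> \<Omega>" for V
  proof
    assume "f constant_on V"
    then obtain c where c: "\<And>z. z \<in> V \<Longrightarrow> f z = c" by (auto simp: constant_on_def)
    obtain z where z: "z \<in> V" using V by blast
    with ex V obtain a b where ab: "(f has_derivative (\<lambda>(h, k). a * h + b * k)) (at z)" "a \<noteq> 0"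
      by blast
    have "(f has_derivative (\<lambda>_. 0)) (at z)"
      by (rule has_derivative_transform_within_open[OF has_derivative_const V(1) z]) (simp add: c)
    with ab(1) have "(\<lambda>(h, k). a * h + b * k) = (\<lambda>_. 0)" by (rule has_derivative_unique)
    then have "(\<lambda>(h, k). a * h + b * k) (1, 0) = (\<lambda>_. 0) (1 :: complex, 0 :: complex)" by (rule fun_cong)
    with ab(2) show False by simp
  qed
  then show ?thesis
    unfolding first_integral_on_def using assms by blast
qed

text \<open>Numerator and denominator are Darboux functions of the vector field with the common
  cofactor \<open>\<kappa>\<close>, so their quotient is annihilated.\<close>

lemma first_integral_on_moebius:
  fixes A B C E A' B' C' E' :: "complex \<Rightarrow> complex" and P Q \<kappa> :: "complex \<Rightarrow> complex \<Rightarrow> complex"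
  assumes "open \<Omega>" and "\<Omega> \<noteq> {}"
    and deriv: "\<And>w x. (w, x) \<in> \<Omega> \<Longrightarrow> (A has_field_derivative A' x) (at x)"
      "\<And>w x. (w, x) \<in> \<Omega> \<Longrightarrow> (B has_field_derivative B' x) (at x)"
      "\<And>w x. (w, x) \<in> \<Omega> \<Longrightarrow> (C has_field_derivative C' x) (at x)"
      "\<And>w x. (w, x) \<in> \<Omega> \<Longrightarrow> (E has_field_derivative E' x) (at x)"
    and denom: "\<And>w x. (w, x) \<in> \<Omega> \<Longrightarrow> C x + E x * w \<noteq> 0"
    and det: "\<And>w x. (w, x) \<in> \<Omega> \<Longrightarrow> A x * E x \<noteq> B x * C x"
    and cofactor_num: "\<And>w x. (w, x) \<in> \<Omega> \<Longrightarrow>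
      B x * P w x + (A' x + B' x * w) * Q w x = \<kappa> w x * (A x + B x * w)"
    and cofactor_denom: "\<And>w x. (w, x) \<in> \<Omega> \<Longrightarrow>
      E x * P w x + (C' x + E' x * w) * Q w x = \<kappa> w x * (C x + E x * w)"
    and f: "\<And>w x. (w, x) \<in> \<Omega> \<Longrightarrow> f (w, x) = (A x + B x * w) / (C x + E x * w)"
  shows "first_integral_on (\<lambda>(w, x). (P w x, Q w x)) f \<Omega>"
proof (rule first_integral_onI[OF assms(1,2)])
  fix z assume z: "z \<in> \<Omega>"
  obtain w x where zwx: "z = (w, x)" by (cases z)
  with z have wx: "(w, x) \<in> \<Omega>" by simp
  let ?N = "A x + B x * w" and ?M = "C x + E x * w"
  \<comment> \<open>The partial derivatives in \<open>w\<close> and in \<open>x\<close> given by the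
    quotient rule.\<close>
  define a where "a = (B x * ?M - ?N * E x) / ?M\<^sup>2"
  define b where "b = ((A' x + B' x * w) * ?M - ?N * (C' x + E' x * w)) / ?M\<^sup>2"
  have M: "?M \<noteq> 0" by (rule denom[OF wx])
  have lift: "((\<lambda>z. F (snd z)) has_derivative (\<lambda>h. F' * snd h)) (at (w, x))"
    if "(F has_field_derivative F') (at x)" for F F' and w :: complex
  proof -
    have "(F has_derivative (\<lambda>h. F' * h)) (at (snd (w, x)))"
      using that by (simp add: has_field_derivative_def)
    from has_derivative_compose[OF has_derivative_snd[OF has_derivative_ident] this]
    show ?thesis by simp
  qed
  have "((\<lambda>z. (A (snd z) + B (snd z) * fst z) / (C (snd z) + E (snd z) * fst z))
      has_derivative (\<lambda>(h, k). a * h + b * k)) (at (w, x))"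
    apply (rule has_derivative_eq_rhs)
     apply (rule has_derivative_divide' has_derivative_add has_derivative_mult
        lift[OF deriv(1)[OF wx]] lift[OF deriv(2)[OF wx]] lift[OF deriv(3)[OF wx]] lift[OF deriv(4)[OF wx]]
        has_derivative_fst has_derivative_ident)+
     apply (use M in simp)
    apply (use M in \<open>simp add: fun_eq_iff a_def b_def power2_eq_square divide_simps\<close>)
    apply (simp add: algebra_simps)
    done
  then have "(f has_derivative (\<lambda>(h, k). a * h + b * k)) (at z)"
    unfolding zwx
    by (rule has_derivative_transform_within_open[OF _ assms(1) wx]) (auto simp: f)
  moreover have "a * P w x + b * Q w x = 0"
  proof -
    have "(a * P w x + b * Q w x) * ?M\<^sup>2
        = (B x * P w x + (A' x + B' x * w) * Q w x) * ?M
          - ?N * (E x * P w x + (C' x + E' x * w) * Q w x)"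
      using M by (simp add: a_def b_def field_simps)
    also have "\<dots> = 0" by (simp add: cofactor_num[OF wx] cofactor_denom[OF wx])
    finally show ?thesis using M by simp
  qed
  \<comment> \<open>The terms in \<open>w\<close> cancel and the numerator of \<open>a\<close> is
    the determinant \<open>B x * C x - A x * E x\<close>.\<close>
  moreover have "a \<noteq> 0"
    using M det[OF wx] by (auto simp: a_def algebra_simps)
  ultimately show "\<exists>a b. (f has_derivative (\<lambda>(h, k). a * h + b * k)) (at z) \<and>
        a * fst (case z of (w, x) \<Rightarrow> (P w x, Q w x)) + b * snd (case z of (w, x) \<Rightarrow> (P w x, Q w x)) = 0 \<and> a \<noteq> 0"
    unfolding zwx by auto
qed

text \<open>Differentiating s^2 = 1 - x^2 gives s s' = -x. At a zero of 1 - x^2 this would force x =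
  0, where 1 - x^2 is 1; hence the domain of a branch never contains 1 or -1.\<close>

lemma sqrt_branch_derivative:
  assumes s: "sqrt_branch S s" and x: "x \<in> S"
  shows "1 - x\<^sup>2 \<noteq> 0" and "s x \<noteq> 0" and "(s has_field_derivative - x * s x / (1 - x\<^sup>2)) (at x)"
proof -
  have S: "open S" "s holomorphic_on S" and sq: "\<And>x. x \<in> S \<Longrightarrow> (s x)\<^sup>2 = 1 - x\<^sup>2"
    using s by (auto simp: sqrt_branch_def)
  have d: "(s has_field_derivative deriv s x) (at x)"
    by (rule holomorphic_derivI[OF S(2,1) x])
  then have "((\<lambda>x. (s x)\<^sup>2) has_field_derivative 2 * s x * deriv s x) (at x)"
    by (auto intro!: derivative_eq_intros)
  then have "((\<lambda>x. 1 - x\<^sup>2) has_field_derivative 2 * s x * deriv s x) (at x)"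
    by (rule has_field_derivative_transform_within_open[OF _ S(1) x]) (rule sq)
  moreover have "((\<lambda>x. 1 - x\<^sup>2) has_field_derivative - 2 * x) (at x)"
    by (auto intro!: derivative_eq_intros)
  ultimately have eq: "s x * deriv s x = - x"
    using DERIV_unique by fastforce
  show nz: "1 - x\<^sup>2 \<noteq> 0"
  proof
    assume R: "1 - x\<^sup>2 = 0"
    with sq[OF x] eq have "x = 0" by simp
    with R show False by simp
  qed
  show "s x \<noteq> 0" using nz sq[OF x] by auto
  moreover have "- x * s x / (1 - x\<^sup>2) = (s x * deriv s x) * s x / (s x)\<^sup>2"
    by (simp only: eq sq[OF x])
  ultimately have "deriv s x = - x * s x / (1 - x\<^sup>2)"
    by (simp add: power2_eq_square)
  with d show "(s has_field_derivative - x * s x / (1 - x\<^sup>2)) (at x)" by simp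
qed

lemma open_nonzero_set:
  fixes g :: "'a::t2_space \<Rightarrow> 'b::t1_space"
  assumes "open T" and "continuous_on T g"
  shows "open {z \<in> T. g z \<noteq> c}"
proof -
  have "{z \<in> T. g z \<noteq> c} = T \<inter> g -` (- {c})" by auto
  with continuous_open_preimage[OF assms(2,1), of "- {c}"] show ?thesis by (simp add: open_Compl)
qed

lemma poly_cheb:
  fixes x :: complex
  shows "poly (pderiv (cheb_T (Suc m))) x = of_nat (Suc m) * poly (cheb_U m) x"
    and "(1 - x\<^sup>2) * poly (pderiv (cheb_U m)) x
       = x * poly (cheb_U m) x - of_nat (Suc m) * poly (cheb_T (Suc m)) x"
    and "(poly (cheb_T (Suc m)) x)\<^sup>2 + (1 - x\<^sup>2) * (poly (cheb_U m) x)\<^sup>2 = 1"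
proof -
  have R: "poly [:1, 0, -1:] x = 1 - x\<^sup>2" by (simp add: power2_eq_square)
  show "poly (pderiv (cheb_T (Suc m))) x = of_nat (Suc m) * poly (cheb_U m) x"
    by (simp add: pderiv_cheb_T del: of_nat_Suc)
  from arg_cong[OF pderiv_cheb_U[of m], of "\<lambda>p. poly p x"]
  show "(1 - x\<^sup>2) * poly (pderiv (cheb_U m)) x
       = x * poly (cheb_U m) x - of_nat (Suc m) * poly (cheb_T (Suc m)) x"
    unfolding poly_mult R poly_diff by simp
  from arg_cong[OF cheb_pell[of m], of "\<lambda>p. poly p x"]
  show "(poly (cheb_T (Suc m)) x)\<^sup>2 + (1 - x\<^sup>2) * (poly (cheb_U m) x)\<^sup>2 = 1"
    unfolding poly_mult poly_add poly_power R by simp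
qed

section \<open>The two Riccati systems over one branch of the square root\<close>

locale cheb_branch =
  fixes S :: "complex set" and s :: "complex \<Rightarrow> complex" and m :: nat
  assumes branch: "sqrt_branch S s"
begin

text \<open>The degree is m + 1, which avoids truncated subtraction in the index of U. Naming the
  functions turns the cofactor conditions into polynomial identities.\<close>

definition n :: complex where "n = of_nat (Suc m)"
definition T where "T = poly (cheb_T (Suc m))"
definition U where "U = poly (cheb_U m)"
definition U' where "U' = poly (pderiv (cheb_U m))"
definition R where "R x = 1 - x\<^sup>2" for x :: complex
definition s' where "s' x = - x * s x / R x" for x

lemma n_nonzero: "n \<noteq> 0"
  by (simp add: n_def del: of_nat_Suc)

lemma pderiv_T: "poly (pderiv (cheb_T (Suc m))) x = n * U x"
  by (simp add: poly_cheb n_def U_def)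

lemma U'_eq: "R x * U' x = x * U x - n * T x"
  by (simp add: R_def U'_def U_def T_def n_def poly_cheb)

lemma pell: "(T x)\<^sup>2 + R x * (U x)\<^sup>2 = 1"
  by (simp add: R_def U_def T_def poly_cheb)

lemma deriv_T: "(T has_field_derivative n * U x) (at x)"
  unfolding T_def pderiv_T[symmetric] by (rule poly_DERIV)

lemma deriv_U: "(U has_field_derivative U' x) (at x)"
  unfolding U_def U'_def by (rule poly_DERIV)

lemma deriv_R: "(R has_field_derivative - 2 * x) (at x)"
  unfolding R_def[abs_def] by (auto intro!: derivative_eq_intros)

lemma S_open_nonempty: "open S" "S \<noteq> {}"
  using branch by (auto simp: sqrt_branch_def)

lemma R_nonzero: "x \<in> S \<Longrightarrow> R x \<noteq> 0"
  and s_nonzero: "x \<in> S \<Longrightarrow> s x \<noteq> 0"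
  and deriv_s: "x \<in> S \<Longrightarrow> (s has_field_derivative s' x) (at x)"
  using sqrt_branch_derivative[OF branch] by (auto simp: R_def s'_def)

text \<open>A solution y gives the Darboux function R y' + \<mu> y v. For y = T this is the
  denominator; for y = s U it is s (R U' + U (\<mu> v - x)), and \<open>U'_eq\<close> turns its part
  free of v into - n s T.\<close>

lemma first_integral_v:
  fixes \<mu> :: complex
  assumes mu: "\<mu> \<noteq> 0" and lam: "lam = (of_nat (Suc m))\<^sup>2"
  shows "first_integral_on
    (\<lambda>(v, x). (lam / \<mu> * (1 - x\<^sup>2) - x * v + \<mu> * v\<^sup>2, 1 - x\<^sup>2))
    (\<lambda>(v, x).
       (poly (pderiv (cheb_U m)) x * (1 - x\<^sup>2) + poly (cheb_U m) x * (\<mu> * v - x))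
       / (poly (pderiv (cheb_T (Suc m))) x * (1 - x\<^sup>2) + \<mu> * poly (cheb_T (Suc m)) x * v) * s x)
    {(v, x). x \<in> S \<and> poly (pderiv (cheb_T (Suc m))) x * (1 - x\<^sup>2) + \<mu> * poly (cheb_T (Suc m)) x * v \<noteq> 0}"
    (is "first_integral_on _ _ ?\<Omega>")
proof -
  have \<Omega>: "?\<Omega> = {z \<in> UNIV \<times> S. R (snd z) * n * U (snd z) + \<mu> * T (snd z) * fst z \<noteq> 0}"
    by (auto simp: pderiv_T R_def T_def mult_ac)
  show ?thesis
  proof (rule first_integral_on_moebius[where A = "\<lambda>x. - n * s x * T x" and B = "\<lambda>x. \<mu> * s x * U x"
        and C = "\<lambda>x. R x * n * U x" and E = "\<lambda>x. \<mu> * T x"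
        and A' = "\<lambda>x. - n * (s' x * T x + s x * (n * U x))" and B' = "\<lambda>x. \<mu> * (s' x * U x + s x * U' x)"
        and C' = "\<lambda>x. n * (- 2 * x * U x + R x * U' x)" and E' = "\<lambda>x. \<mu> * (n * U x)"
        and \<kappa> = "\<lambda>v x. \<mu> * v - x"])
    show "open ?\<Omega>"
      unfolding \<Omega> T_def U_def R_def
      by (intro open_nonzero_set open_Times open_UNIV S_open_nonempty(1) continuous_intros)
    show "?\<Omega> \<noteq> {}"
    proof -
      obtain x where x: "x \<in> S" using S_open_nonempty(2) by blast
      \<comment> \<open>If the denominator vanished for every v, the values 0 and 1 would give U x =
        T x = 0, against the Pell equation.\<close>
      have "\<exists>v. R x * n * U x + \<mu> * T x * v \<noteq> 0"
      proof (rule ccontr)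
        assume "\<not> ?thesis"
        then have 0: "R x * n * U x + \<mu> * T x * v = 0" for v by blast
        from 0[of 0] n_nonzero R_nonzero[OF x] have "U x = 0" by simp
        with 0[of 1] mu have "T x = 0" by simp
        with \<open>U x = 0\<close> pell[of x] show False by simp
      qed
      with x show ?thesis unfolding \<Omega> by auto
    qed
  next
    fix v x assume "(v, x) \<in> ?\<Omega>"
    then have x: "x \<in> S" and nz: "R x * n * U x + \<mu> * T x * v \<noteq> 0" unfolding \<Omega> by auto
    have s'R: "R x * s' x = - x * s x" using R_nonzero[OF x] by (simp add: s'_def)
    have Req: "1 - x\<^sup>2 = R x" by (simp add: R_def)
    note d = deriv_T deriv_U deriv_s[OF x] deriv_R
    show "((\<lambda>x. - n * s x * T x) has_field_derivative - n * (s' x * T x + s x * (n * U x))) (at x)"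
      by (rule derivative_eq_intros d refl)+ (simp add: algebra_simps)
    show "((\<lambda>x. \<mu> * s x * U x) has_field_derivative \<mu> * (s' x * U x + s x * U' x)) (at x)"
      by (rule derivative_eq_intros d refl)+ (simp add: algebra_simps)
    show "((\<lambda>x. R x * n * U x) has_field_derivative n * (- 2 * x * U x + R x * U' x)) (at x)"
      by (rule derivative_eq_intros d refl)+ (simp add: algebra_simps)
    show "((\<lambda>x. \<mu> * T x) has_field_derivative \<mu> * (n * U x)) (at x)"
      by (rule derivative_eq_intros d refl)+ (simp add: algebra_simps)
    show "R x * n * U x + \<mu> * T x * v \<noteq> 0" by (rule nz)
    show "- n * s x * T x * (\<mu> * T x) \<noteq> \<mu> * s x * U x * (R x * n * U x)"
    proof
      assume "- n * s x * T x * (\<mu> * T x) = \<mu> * s x * U x * (R x * n * U x)"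
      \<comment> \<open>Up to sign the determinant is n \<mu> s times the left side of the Pell
        equation, hence nonzero.\<close>
      then have "n * \<mu> * s x * ((T x)\<^sup>2 + R x * (U x)\<^sup>2) = 0"
        by algebra
      with pell n_nonzero mu s_nonzero[OF x] show False by simp
    qed
    \<comment> \<open>Multiplying by \<mu> clears the only division, so that both cofactor
      conditions become polynomial.\<close>
    have l: "\<mu> * (lam / \<mu> * R x - x * v + \<mu> * v\<^sup>2) = n\<^sup>2 * R x - \<mu> * x * v + (\<mu> * v)\<^sup>2"
      using mu by (simp add: lam n_def[symmetric] field_simps power2_eq_square del: of_nat_Suc)
    have "\<mu> * s x * U x * (lam / \<mu> * R x - x * v + \<mu> * v\<^sup>2)
        = s x * U x * (\<mu> * (lam / \<mu> * R x - x * v + \<mu> * v\<^sup>2))" by (simp only: mult_ac)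
    then show "\<mu> * s x * U x * (lam / \<mu> * (1 - x\<^sup>2) - x * v + \<mu> * v\<^sup>2) +
          (- n * (s' x * T x + s x * (n * U x)) + \<mu> * (s' x * U x + s x * U' x) * v) * (1 - x\<^sup>2) =
          (\<mu> * v - x) * (- n * s x * T x + \<mu> * s x * U x * v)"
      unfolding Req l using s'R U'_eq[of x] by algebra
    have "\<mu> * T x * (lam / \<mu> * R x - x * v + \<mu> * v\<^sup>2)
        = T x * (\<mu> * (lam / \<mu> * R x - x * v + \<mu> * v\<^sup>2))" by (simp only: mult_ac)
    then show "\<mu> * T x * (lam / \<mu> * (1 - x\<^sup>2) - x * v + \<mu> * v\<^sup>2) +
          (n * (- 2 * x * U x + R x * U' x) + \<mu> * (n * U x) * v) * (1 - x\<^sup>2) =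
          (\<mu> * v - x) * (R x * n * U x + \<mu> * T x * v)"
      unfolding Req l using U'_eq[of x] by algebra
    have num: "(U' x * R x + U x * (\<mu> * v - x)) * s x = - n * s x * T x + \<mu> * s x * U x * v"
      using U'_eq[of x] by algebra
    show "(case (v, x) of (v, x) \<Rightarrow>
       (poly (pderiv (cheb_U m)) x * (1 - x\<^sup>2) + poly (cheb_U m) x * (\<mu> * v - x))
       / (poly (pderiv (cheb_T (Suc m))) x * (1 - x\<^sup>2) + \<mu> * poly (cheb_T (Suc m)) x * v) * s x)
      = (- n * s x * T x + \<mu> * s x * U x * v) / (R x * n * U x + \<mu> * T x * v)"
      unfolding prod.case pderiv_T num[symmetric] Req
      by (simp add: U_def T_def U'_def mult_ac)
  qed
qed

text \<open>Here w stands for the logarithmic derivative of R^(1/4) y, the substitution that removes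
  the first order term. The Darboux function of y is R y (y'/y - x/(2R) - w). For y = s U the
  logarithmic derivative of s contributes a further - x/R, whence the coefficient 3 in the
  numerator.\<close>

lemma first_integral_w:
  assumes lam: "lam = (of_nat (Suc m))\<^sup>2"
  shows "first_integral_on
    (\<lambda>(w, x). (- 2 - 4 * lam + (4 * lam - 1) * x\<^sup>2 - 4 * (1 - x\<^sup>2)\<^sup>2 * w\<^sup>2, 4 * (1 - x\<^sup>2)\<^sup>2))
    (\<lambda>(w, x).
       (- w + poly (pderiv (cheb_U m)) x / poly (cheb_U m) x - 3 * x / (2 * (1 - x\<^sup>2)))
       / (- w + poly (pderiv (cheb_T (Suc m))) x / poly (cheb_T (Suc m)) x - x / (2 * (1 - x\<^sup>2)))
       * (poly (cheb_U m) x / poly (cheb_T (Suc m)) x) * s x)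
    {(w, x). x \<in> S \<and> 1 - x\<^sup>2 \<noteq> 0 \<and> poly (cheb_U m) x \<noteq> 0 \<and> poly (cheb_T (Suc m)) x \<noteq> 0 \<and>
       - w + poly (pderiv (cheb_T (Suc m))) x / poly (cheb_T (Suc m)) x - x / (2 * (1 - x\<^sup>2)) \<noteq> 0}"
    (is "first_integral_on _ _ ?\<Omega>")
proof -
  define G where "G = {x \<in> S. U x * T x \<noteq> 0}"
  have "open G"
    unfolding G_def T_def U_def by (intro open_nonzero_set S_open_nonempty(1) continuous_intros)
  \<comment> \<open>U T has finitely many zeros, whereas a nonempty open subset of the plane is
    infinite.\<close>
  have "G \<noteq> {}"
  proof
    assume "G = {}"
    then have "S \<subseteq> {x. poly (cheb_U m * cheb_T (Suc m)) x = 0}" by (auto simp: G_def U_def T_def)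
    moreover have "finite {x. poly (cheb_U m * cheb_T (Suc m)) x = 0}"
      by (intro poly_roots_finite) (simp add: cheb_U_nonzero cheb_T_nonzero)
    ultimately have "finite S" by (rule finite_subset)
    with S_open_nonempty show False using finite_imp_not_open by blast
  qed
  have \<Omega>: "?\<Omega> = {z \<in> UNIV \<times> G. - fst z + n * U (snd z) / T (snd z) - snd z / (2 * R (snd z)) \<noteq> 0}"
    unfolding pderiv_T using R_nonzero by (auto simp: G_def T_def U_def R_def)
  show ?thesis
  proof (rule first_integral_on_moebius[where A = "\<lambda>x. - s x * (n * T x + x * U x / 2)" and B = "\<lambda>x. - s x * R x * U x"
        and C = "\<lambda>x. n * R x * U x - x * T x / 2" and E = "\<lambda>x. - R x * T x"
        and A' = "\<lambda>x. - s' x * (n * T x + x * U x / 2) - s x * (n * (n * U x) + (U x + x * U' x) / 2)"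
        and B' = "\<lambda>x. - s' x * R x * U x + 2 * x * s x * U x - s x * R x * U' x"
        and C' = "\<lambda>x. n * (- 2 * x * U x + R x * U' x) - (T x + x * (n * U x)) / 2"
        and E' = "\<lambda>x. 2 * x * T x - R x * (n * U x)"
        and \<kappa> = "\<lambda>w x. - 6 * x * R x - 4 * (R x)\<^sup>2 * w"])
    show "open ?\<Omega>"
      unfolding \<Omega> T_def U_def R_def
      by (intro open_nonzero_set open_Times open_UNIV \<open>open G\<close> continuous_intros)
         (use R_nonzero in \<open>auto simp: G_def T_def R_def\<close>)
    show "?\<Omega> \<noteq> {}"
    proof -
      obtain x where x: "x \<in> G" using \<open>G \<noteq> {}\<close> by blast
      \<comment> \<open>This w makes the excluded factor equal to 1.\<close>
      then have "(n * U x / T x - x / (2 * R x) - 1, x) \<in> ?\<Omega>" unfolding \<Omega> by simp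
      then show ?thesis by blast
    qed
  next
    fix w x assume "(w, x) \<in> ?\<Omega>"
    then have x: "x \<in> S" and U0: "U x \<noteq> 0" and T0: "T x \<noteq> 0"
      and nz: "- w + n * U x / T x - x / (2 * R x) \<noteq> 0" unfolding \<Omega> by (auto simp: G_def)
    note R_nonzero = R_nonzero[OF x]
    have s'R: "R x * s' x = - x * s x" using R_nonzero by (simp add: s'_def)
    have Req: "1 - x\<^sup>2 = R x" by (simp add: R_def)
    have x2: "x\<^sup>2 = 1 - R x" by (simp add: R_def)
    note d = deriv_T deriv_U deriv_s[OF x] deriv_R
    show "((\<lambda>x. - s x * (n * T x + x * U x / 2)) has_field_derivative
        - s' x * (n * T x + x * U x / 2) - s x * (n * (n * U x) + (U x + x * U' x) / 2)) (at x)"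
      by (rule derivative_eq_intros d refl | simp)+
    show "((\<lambda>x. - s x * R x * U x) has_field_derivative
        - s' x * R x * U x + 2 * x * s x * U x - s x * R x * U' x) (at x)"
      by (rule derivative_eq_intros d refl)+ (simp add: algebra_simps)
    show "((\<lambda>x. n * R x * U x - x * T x / 2) has_field_derivative
        n * (- 2 * x * U x + R x * U' x) - (T x + x * (n * U x)) / 2) (at x)"
      by (rule derivative_eq_intros d refl | simp)+ (simp add: algebra_simps)
    show "((\<lambda>x. - R x * T x) has_field_derivative 2 * x * T x - R x * (n * U x)) (at x)"
      by (rule derivative_eq_intros d refl)+ (simp add: algebra_simps)
    have denom: "n * R x * U x - x * T x / 2 + - R x * T x * w
        = R x * T x * (- w + n * U x / T x - x / (2 * R x))"
      using T0 R_nonzero by (simp add: field_simps)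
    with nz T0 R_nonzero show "n * R x * U x - x * T x / 2 + - R x * T x * w \<noteq> 0" by simp
    show "- s x * (n * T x + x * U x / 2) * (- R x * T x) \<noteq> - s x * R x * U x * (n * R x * U x - x * T x / 2)"
    proof
      assume "- s x * (n * T x + x * U x / 2) * (- R x * T x) = - s x * R x * U x * (n * R x * U x - x * T x / 2)"
      \<comment> \<open>The products of T and U cancel in the determinant, and the Pell equation
        evaluates the rest to n R s.\<close>
      then have "n * R x * s x * ((T x)\<^sup>2 + R x * (U x)\<^sup>2) = 0"
        by algebra
      with pell n_nonzero R_nonzero s_nonzero[OF x] show False by simp
    qed
    have l: "lam = n\<^sup>2" by (simp only: lam n_def)
    show "- s x * R x * U x * (- 2 - 4 * lam + (4 * lam - 1) * x\<^sup>2 - 4 * (1 - x\<^sup>2)\<^sup>2 * w\<^sup>2) +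
          (- s' x * (n * T x + x * U x / 2) - s x * (n * (n * U x) + (U x + x * U' x) / 2) +
           (- s' x * R x * U x + 2 * x * s x * U x - s x * R x * U' x) * w) * (4 * (1 - x\<^sup>2)\<^sup>2) =
          (- 6 * x * R x - 4 * (R x)\<^sup>2 * w) * (- s x * (n * T x + x * U x / 2) + - s x * R x * U x * w)"
      unfolding Req l using s'R U'_eq[of x] x2 by algebra
    show "- R x * T x * (- 2 - 4 * lam + (4 * lam - 1) * x\<^sup>2 - 4 * (1 - x\<^sup>2)\<^sup>2 * w\<^sup>2) +
          (n * (- 2 * x * U x + R x * U' x) - (T x + x * (n * U x)) / 2 + (2 * x * T x - R x * (n * U x)) * w) * (4 * (1 - x\<^sup>2)\<^sup>2) =
          (- 6 * x * R x - 4 * (R x)\<^sup>2 * w) * (n * R x * U x - x * T x / 2 + - R x * T x * w)"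
      unfolding Req l using U'_eq[of x] x2 by algebra
    have num: "- s x * (n * T x + x * U x / 2) + - s x * R x * U x * w
        = s x * R x * U x * (- w + U' x / U x - 3 * x / (2 * R x))"
    proof -
      have "s x * R x * U x * (- w + U' x / U x - 3 * x / (2 * R x))
          = s x * (- R x * U x * w + R x * U' x - 3 * x * U x / 2)"
        using U0 R_nonzero by (simp add: field_simps)
      then show ?thesis unfolding U'_eq by (simp add: field_simps)
    qed
    show "(case (w, x) of (w, x) \<Rightarrow>
       (- w + poly (pderiv (cheb_U m)) x / poly (cheb_U m) x - 3 * x / (2 * (1 - x\<^sup>2)))
       / (- w + poly (pderiv (cheb_T (Suc m))) x / poly (cheb_T (Suc m)) x - x / (2 * (1 - x\<^sup>2)))
       * (poly (cheb_U m) x / poly (cheb_T (Suc m)) x) * s x)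
      = (- s x * (n * T x + x * U x / 2) + - s x * R x * U x * w)
        / (n * R x * U x - x * T x / 2 + - R x * T x * w)"
      unfolding prod.case pderiv_T num denom Req U'_def[symmetric] U_def[symmetric] T_def[symmetric]
      using R_nonzero by (simp add: mult_ac)
  qed
qed

end

section \<open>Derivations and field homomorphisms\<close>

context
  fixes D :: "'a::field \<Rightarrow> 'a"
  assumes D: "is_derivation D"
begin

lemma derivation_add: "D (a + b) = D a + D b"
  and derivation_mult: "D (a * b) = D a * b + a * D b"
  using D by (auto simp: is_derivation_def)

lemma derivation_0: "D 0 = 0"
  by (metis derivation_add add.right_neutral add_cancel_right_right)

lemma derivation_1: "D 1 = 0"
  by (metis derivation_mult mult_1 mult_1_right add_cancel_right_right)

lemma derivation_minus: "D (- a) = - D a"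
  using derivation_add[of a "- a"] by (simp add: derivation_0 eq_neg_iff_add_eq_0 add.commute)

lemma derivation_diff: "D (a - b) = D a - D b"
  using derivation_add[of a "- b"] by (simp add: derivation_minus)

lemma derivation_power2: "D (a\<^sup>2) = 2 * a * D a"
  by (simp add: power2_eq_square derivation_mult)

lemma derivation_divide:
  assumes "b \<noteq> 0"
  shows "D (a / b) = (D a * b - a * D b) / b\<^sup>2"
proof -
  have "D a = D (a / b * b)" using assms by simp
  also have "\<dots> = D (a / b) * b + a / b * D b" by (rule derivation_mult)
  finally show ?thesis using assms by (simp add: field_simps power2_eq_square)
qed

end

context
  fixes f :: "'a::field \<Rightarrow> 'b::field"
  assumes f: "is_field_hom f"
begin

lemma field_hom_1: "f 1 = 1"
  and field_hom_add: "f (a + b) = f a + f b"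
  and field_hom_mult: "f (a * b) = f a * f b"
  using f by (auto simp: is_field_hom_def)

lemma field_hom_0: "f 0 = 0"
  by (metis field_hom_add add.right_neutral add_cancel_right_right)

lemma field_hom_minus: "f (- a) = - f a"
  using field_hom_add[of a "- a"] by (simp add: field_hom_0 eq_neg_iff_add_eq_0 add.commute)

lemma field_hom_diff: "f (a - b) = f a - f b"
  using field_hom_add[of a "- b"] by (simp add: field_hom_minus)

lemma field_hom_eq_0_iff: "f a = 0 \<longleftrightarrow> a = 0"
proof
  assume "f a = 0"
  then have "f (a * inverse a) = 0" by (simp add: field_hom_mult)
  then show "a = 0" using field_hom_1 by (cases "a = 0") auto
qed (simp add: field_hom_0)

lemma field_hom_eq_iff: "f a = f b \<longleftrightarrow> a = b"
  using field_hom_eq_0_iff[of "a - b"] by (simp add: field_hom_diff)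

lemma field_hom_inverse: "f (inverse a) = inverse (f a)"
proof (cases "a = 0")
  case False
  then have "f (inverse a) * f a = 1" by (simp add: field_hom_1 flip: field_hom_mult)
  then show ?thesis by (metis inverse_unique mult.commute)
qed (simp add: field_hom_0)

lemma field_hom_divide: "f (a / b) = f a / f b"
  by (simp add: divide_inverse field_hom_mult field_hom_inverse)

lemma field_hom_power2: "f (a\<^sup>2) = (f a)\<^sup>2"
  by (simp add: power2_eq_square field_hom_mult)

lemma field_hom_of_nat: "f (of_nat k) = of_nat k"
  by (induction k) (simp_all add: field_hom_0 field_hom_1 field_hom_add)

end

section \<open>Quadratic extensions of differential fields\<close>

text \<open>Cancellation excludes \<open>g \<otimes> g = g\<close>, so \<open>g\<close> is an
  involution and the group table is determined.\<close>

lemma (in group) iso_integer_mod_group_2: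
  assumes "carrier G = {\<one>, g}" and "g \<noteq> \<one>"
  shows "G \<cong> integer_mod_group 2"
proof (rule is_isoI, rule isoI)
  let ?h = "\<lambda>x. if x = \<one> then 0 else (1 :: int)"
  have gG: "g \<in> carrier G" by (simp add: assms(1))
  have "g \<otimes> g \<noteq> g" using gG assms(2) by (metis l_cancel_one)
  moreover have "g \<otimes> g \<in> {\<one>, g}" using gG m_closed assms(1) by blast
  ultimately have gg: "g \<otimes> g = \<one>" by blast
  show "?h \<in> hom G (integer_mod_group 2)"
    using gG assms(2) by (auto simp: hom_def assms(1) carrier_integer_mod_group gg)
  have "{0..<2} = {0, 1 :: int}" by auto
  then show "bij_betw ?h (carrier G) (carrier (integer_mod_group 2))"
    using assms(2) by (auto simp: bij_betw_def assms(1) carrier_integer_mod_group)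
qed

text \<open>\<open>s_notin\<close> makes 1 and \<open>s\<close> linearly independent over the image
  of K, and \<open>two_nonzero\<close> separates \<open>s\<close> from \<open>- s\<close>. That they
  span the whole field is assumed only in \<open>diff_galois_group_iso\<close>.\<close>

locale quadratic_diff_ext =
  fixes d :: "'k::field \<Rightarrow> 'k" and D :: "'l::field \<Rightarrow> 'l" and \<iota> :: "'k \<Rightarrow> 'l" and s :: 'l and r :: 'k
  assumes ext: "diff_field_ext d D \<iota>" and s_square: "s\<^sup>2 = \<iota> r" and s_notin: "s \<notin> range \<iota>"
    and two_nonzero: "(2 :: 'l) \<noteq> 0"
begin

lemma derD: "is_derivation D" and derd: "is_derivation d" and hom: "is_field_hom \<iota>"
  and D_emb: "D (\<iota> a) = \<iota> (d a)"
  using ext by (auto simp: diff_field_ext_def)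

lemma s_nonzero: "s \<noteq> 0"
  using s_notin field_hom_0[OF hom] by (metis rangeI)

lemma emb_two: "\<iota> 2 = 2"
  using field_hom_of_nat[OF hom, of 2] by simp

text \<open>Differentiate s^2 = r and divide by 2 s. Thus K + K s is closed under
  \<open>D\<close>.\<close>

lemma D_s: "D s = \<iota> (d r / (2 * r)) * s"
proof -
  have "2 * s * D s = \<iota> (d r)"
    by (simp flip: derivation_power2[OF derD] D_emb add: s_square)
  then have "D s = \<iota> (d r) / (2 * s\<^sup>2) * s"
    using s_nonzero two_nonzero by (simp add: field_simps power2_eq_square)
  then show ?thesis
    by (simp add: s_square field_hom_divide[OF hom] field_hom_mult[OF hom] emb_two)
qed

lemma basis_eq_0: "\<iota> a + \<iota> b * s = 0 \<longleftrightarrow> a = 0 \<and> b = 0"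
proof
  assume eq: "\<iota> a + \<iota> b * s = 0"
  have "b = 0"
  proof (rule ccontr)
    assume "b \<noteq> 0"
    with eq have "s = \<iota> (- a / b)"
      by (simp add: field_hom_divide[OF hom] field_hom_minus[OF hom] field_hom_eq_0_iff[OF hom]
          field_simps eq_neg_iff_add_eq_0)
    with s_notin show False by blast
  qed
  with eq show "a = 0 \<and> b = 0"
    by (simp add: field_hom_0[OF hom] field_hom_eq_0_iff[OF hom])
qed (simp add: field_hom_0[OF hom])

lemma basis_eq: "\<iota> a + \<iota> b * s = \<iota> a' + \<iota> b' * s \<longleftrightarrow> a = a' \<and> b = b'"
  using basis_eq_0[of "a - a'" "b - b'"] by (auto simp: field_hom_diff[OF hom] algebra_simps)

lemma basis_add: "(\<iota> a + \<iota> b * s) + (\<iota> a' + \<iota> b' * s) = \<iota> (a + a') + \<iota> (b + b') * s"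
  by (simp add: field_hom_add[OF hom] algebra_simps)

lemma basis_mult: "(\<iota> a + \<iota> b * s) * (\<iota> a' + \<iota> b' * s)
    = \<iota> (a * a' + b * b' * r) + \<iota> (a * b' + b * a') * s"
  by (simp add: field_hom_add[OF hom] field_hom_mult[OF hom] flip: s_square)
     (simp add: algebra_simps power2_eq_square)

lemma basis_D: "D (\<iota> a + \<iota> b * s) = \<iota> (d a) + \<iota> (d b + b * (d r / (2 * r))) * s"
proof -
  define q where "q = d r / (2 * r)"
  have "D s = \<iota> q * s" by (simp only: q_def D_s)
  then show ?thesis
    unfolding q_def[symmetric]
    by (simp add: derivation_add[OF derD] derivation_mult[OF derD] D_emb field_hom_add[OF hom]
        field_hom_mult[OF hom] algebra_simps)
qed

lemma basis_inverse: "\<exists>a' b'. inverse (\<iota> a + \<iota> b * s) = \<iota> a' + \<iota> b' * s"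
proof (cases "a = 0 \<and> b = 0")
  case True
  then have "inverse (\<iota> a + \<iota> b * s) = \<iota> 0 + \<iota> 0 * s" by (simp add: field_hom_0[OF hom])
  then show ?thesis by blast
next
  case False
  \<comment> \<open>The norm, the product of the element with its conjugate; the conjugate over the
    norm is the inverse.\<close>
  let ?N = "a\<^sup>2 - b\<^sup>2 * r"
  have nz: "\<iota> a + \<iota> b * s \<noteq> 0" "\<iota> a - \<iota> b * s \<noteq> 0"
    using False basis_eq_0[of a b] basis_eq_0[of a "- b"] by (auto simp: field_hom_minus[OF hom])
  have N: "(\<iota> a + \<iota> b * s) * (\<iota> a - \<iota> b * s) = \<iota> ?N"
    by (simp add: field_hom_diff[OF hom] field_hom_mult[OF hom] field_hom_power2[OF hom] flip: s_square)
       (simp add: algebra_simps power2_eq_square)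
  have "inverse (\<iota> a + \<iota> b * s) = (\<iota> a - \<iota> b * s) / \<iota> ?N"
    unfolding N[symmetric] using nz by (simp add: inverse_eq_divide)
  also have "\<dots> = \<iota> (a / ?N) + \<iota> (- b / ?N) * s"
    by (simp add: field_hom_divide[OF hom] field_hom_minus[OF hom] diff_divide_distrib)
  finally show ?thesis by blast
qed

text \<open>This feeds the generation clause of \<open>picard_vessiot\<close>: once K + K s contains
  the two generating solutions, it is the whole extension.\<close>

lemma diff_subfield_basis: "diff_subfield D {\<iota> a + \<iota> b * s |a b. True}" (is "diff_subfield D ?F")
  unfolding diff_subfield_def
proof (intro conjI ballI)
  have "\<iota> 1 + \<iota> 0 * s = 1" by (simp add: field_hom_0[OF hom] field_hom_1[OF hom])
  then show "1 \<in> ?F" by (metis (mono_tags, lifting) mem_Collect_eq)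
next
  fix x y assume "x \<in> ?F" "y \<in> ?F"
  then obtain a b a' b' where x: "x = \<iota> a + \<iota> b * s" and y: "y = \<iota> a' + \<iota> b' * s" by blast
  have "x - y = \<iota> (a - a') + \<iota> (b - b') * s"
    by (simp add: x y field_hom_diff[OF hom] algebra_simps)
  then show "x - y \<in> ?F" by blast
  show "x * y \<in> ?F" unfolding x y basis_mult by blast
next
  fix x assume "x \<in> ?F"
  then obtain a b where x: "x = \<iota> a + \<iota> b * s" by blast
  show "inverse x \<in> ?F" unfolding x using basis_inverse by blast
  show "D x \<in> ?F" unfolding x basis_D by blast
qed

lemma diff_galois_group_iso:
  assumes gen: "\<And>z. \<exists>a b. z = \<iota> a + \<iota> b * s"
  shows "diff_galois_group D \<iota> \<cong> integer_mod_group 2"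
proof -
  \<comment> \<open>Coordinates with respect to 1 and \<open>s\<close>; they are unique by
    \<open>basis_eq\<close>, so conjugation can be defined through them.\<close>
  obtain A B where AB: "\<And>z. z = \<iota> (A z) + \<iota> (B z) * s" using gen by metis
  define \<tau> where "\<tau> z = \<iota> (A z) - \<iota> (B z) * s" for z
  have AB_basis: "A (\<iota> a + \<iota> b * s) = a" "B (\<iota> a + \<iota> b * s) = b" for a b
    using AB[of "\<iota> a + \<iota> b * s"] by (metis basis_eq)+
  have \<tau>: "\<tau> (\<iota> a + \<iota> b * s) = \<iota> a + \<iota> (- b) * s" for a b
    by (simp add: \<tau>_def AB_basis field_hom_minus[OF hom])
  have \<tau>_emb: "\<tau> (\<iota> k) = \<iota> k" for k
    using \<tau>[of k 0] by (simp add: field_hom_0[OF hom])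
  have \<tau>_s: "\<tau> s = - s"
    using \<tau>[of 0 1] by (simp add: field_hom_0[OF hom] field_hom_minus[OF hom] field_hom_1[OF hom])
  have \<tau>_add: "\<tau> (x + y) = \<tau> x + \<tau> y" and \<tau>_mult: "\<tau> (x * y) = \<tau> x * \<tau> y"
    and \<tau>_D: "\<tau> (D x) = D (\<tau> x)" and \<tau>_\<tau>: "\<tau> (\<tau> x) = x" for x y
  proof -
    obtain a b a' b' where x: "x = \<iota> a + \<iota> b * s" and y: "y = \<iota> a' + \<iota> b' * s"
      using gen by metis
    show "\<tau> (x + y) = \<tau> x + \<tau> y" unfolding x y basis_add \<tau> by simp
    show "\<tau> (x * y) = \<tau> x * \<tau> y" unfolding x y basis_mult \<tau> by simp
    show "\<tau> (D x) = D (\<tau> x)" unfolding x basis_D \<tau> by (simp add: derivation_minus[OF derd])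
    show "\<tau> (\<tau> x) = x" unfolding x \<tau> by simp
  qed
  have \<tau>_mem: "\<tau> \<in> carrier (diff_galois_group D \<iota>)"
    using \<tau>_\<tau> \<tau>_add \<tau>_mult \<tau>_D \<tau>_emb \<tau>_emb[of 1]
    by (auto simp: diff_galois_group_def is_field_hom_def field_hom_1[OF hom] intro!: o_bij[of \<tau> \<tau>])
  have "\<tau> \<noteq> id"
  proof
    assume "\<tau> = id"
    with \<tau>_s have "2 * s = 0" by simp
    with two_nonzero s_nonzero show False by simp
  qed
  moreover have "carrier (diff_galois_group D \<iota>) = {id, \<tau>}"
  proof (intro equalityI subsetI)
    fix \<sigma> assume "\<sigma> \<in> carrier (diff_galois_group D \<iota>)"
    then have \<sigma>: "is_field_hom \<sigma>" and \<sigma>_emb: "\<And>k. \<sigma> (\<iota> k) = \<iota> k"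
      by (auto simp: diff_galois_group_def)
    have \<sigma>_eq: "\<sigma> z = \<iota> (A z) + \<iota> (B z) * \<sigma> s" for z
      by (subst (1) AB[of z]) (simp add: field_hom_add[OF \<sigma>] field_hom_mult[OF \<sigma>] \<sigma>_emb)
    \<comment> \<open>An automorphism is determined by the image of \<open>s\<close>, which must be
      a root of the same quadratic equation.\<close>
    have "(\<sigma> s)\<^sup>2 = s\<^sup>2"
      by (simp add: s_square \<sigma>_emb flip: field_hom_power2[OF \<sigma>])
    then consider "\<sigma> s = s" | "\<sigma> s = - s" by (auto simp: power2_eq_iff)
    then show "\<sigma> \<in> {id, \<tau>}"
    proof cases
      case 1
      have "\<sigma> z = id z" for z
        unfolding \<sigma>_eq[of z] 1 id_apply by (rule AB[symmetric])
      then show ?thesis by (simp add: fun_eq_iff)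
    next
      case 2
      have "\<sigma> z = \<tau> z" for z
        unfolding \<sigma>_eq[of z] 2 \<tau>_def by simp
      then show ?thesis by (simp add: fun_eq_iff)
    qed
  next
    fix \<sigma> assume "\<sigma> \<in> {id, \<tau>}"
    then show "\<sigma> \<in> carrier (diff_galois_group D \<iota>)"
      using \<tau>_mem by (auto simp: diff_galois_group_def is_field_hom_def)
  qed
  ultimately show ?thesis
    using group.iso_integer_mod_group_2[OF group_diff_galois_group[of D \<iota>], of \<tau>]
    by (simp add: diff_galois_group_def)
qed

end

section \<open>The Picard--Vessiot extension of the Chebyshev equation\<close>

text \<open>For a / b in lowest terms, a' b = a b' makes b divide b'. In characteristic 0 this
  forces b to be a constant, and then a' = 0.\<close>

lemma consts_of_fract_deriv:
  fixes f :: "'a::{field_gcd, field_char_0} poly fract"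
  assumes "f \<in> consts_of fract_deriv"
  shows "\<exists>c. f = Fract [:c:] 1"
proof -
  define a where "a = fst (quot_of_fract f)"
  define b where "b = snd (quot_of_fract f)"
  have f: "f = Fract a b" and b: "b \<noteq> 0" and ab: "coprime a b"
    by (simp_all add: a_def b_def coprime_quot_of_fract)
  have "Fract (pderiv a * b - a * pderiv b) (b\<^sup>2) = 0"
    using assms by (simp add: consts_of_def f fract_deriv_Fract[OF b])
  then have eq: "pderiv a * b = a * pderiv b"
    using b by (simp add: Zero_fract_def eq_fract)
  then have "b dvd a * pderiv b" by (metis dvd_triv_right)
  with ab have "b dvd pderiv b" by (simp add: coprime_dvd_mult_right_iff coprime_commute)
  then have "degree b = 0" by simp
  then obtain e where e: "b = [:e:]" by (rule degree_eq_zeroE)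
  with eq b have "pderiv a = 0" by simp
  then obtain c where c: "a = [:c:]" using pderiv_iszero by blast
  have "f = Fract [:c / e:] 1"
    using b by (simp add: f c e eq_fract)
  then show ?thesis by blast
qed

text \<open>Compare orders of vanishing at 1: after clearing denominators one side has even order
  and the other odd order.\<close>

lemma not_square_in_fract:
  fixes f :: "complex poly fract"
  shows "f\<^sup>2 \<noteq> Fract [:1, 0, -1:] 1"
proof
  assume eq: "f\<^sup>2 = Fract [:1, 0, -1:] 1"
  obtain a b where f: "f = Fract a b" and b: "b \<noteq> 0" by (cases f)
  have "a\<^sup>2 = [:1, 0, -1:] * b\<^sup>2"
    using eq b unfolding f power2_eq_square by (simp add: eq_fract del: mult_pCons_left mult_pCons_right)
  also have "[:1, 0, -1:] = - ([:-1, 1:] * [:1, 1 :: complex:])" by simp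
  finally have ab: "a\<^sup>2 = - ([:-1, 1:] * [:1, 1:]) * b\<^sup>2" .
  have a: "a \<noteq> 0" using ab b by (auto simp del: mult_pCons_left mult_pCons_right)
  have "Polynomial.order 1 (a\<^sup>2) = 2 * Polynomial.order 1 a" using a by (simp add: power2_eq_square order_mult)
  moreover have "Polynomial.order 1 (- ([:-1, 1:] * [:1, 1:]) * b\<^sup>2) = 1 + 2 * Polynomial.order 1 b"
  proof -
    have o1: "Polynomial.order 1 [:-1, 1 :: complex:] = 1" using order_power_n_n[of "1::complex" 1] by simp
    have o2: "Polynomial.order 1 [:1, 1 :: complex:] = 0" by (rule order_0I) simp
    have "Polynomial.order 1 (- ([:-1, 1:] * [:1, 1:]) * b\<^sup>2)
        = Polynomial.order 1 (- ([:-1, 1:] * [:1, 1 :: complex:])) + Polynomial.order 1 (b\<^sup>2)"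
      by (rule order_mult) (use b in \<open>simp del: mult_pCons_left mult_pCons_right\<close>)
    also have "Polynomial.order 1 (- ([:-1, 1:] * [:1, 1 :: complex:])) = Polynomial.order 1 ([:-1, 1:] * [:1, 1 :: complex:])"
      by (rule order_uminus)
    also have "\<dots> = Polynomial.order 1 [:-1, 1 :: complex:] + Polynomial.order 1 [:1, 1 :: complex:]"
      by (rule order_mult) simp
    also have "Polynomial.order 1 (b\<^sup>2) = 2 * Polynomial.order 1 b" using b by (simp add: power2_eq_square order_mult)
    finally show ?thesis by (simp add: o1 o2)
  qed
  ultimately have "2 * Polynomial.order 1 a = 1 + 2 * Polynomial.order 1 b" using ab by simp
  then show False by presburger
qed

text \<open>\<open>X\<close>, \<open>R\<close>, \<open>t\<close>, \<open>u\<close> and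
  \<open>N\<close> stand for the images in L of x, 1 - x^2, T, U and n. Recording only their
  relations lets the solutions be studied by field computations in L.\<close>

locale cheb_ext =
  fixes D :: "'l::field \<Rightarrow> 'l" and X R t u N :: 'l
  assumes der: "is_derivation D"
    and DX: "D X = 1" and R: "R = 1 - X\<^sup>2" and R0: "R \<noteq> 0" and DN: "D N = 0" and N0: "N \<noteq> 0"
    and Dt: "D t = N * u" and Du: "R * D u = X * u - N * t" and pell: "t\<^sup>2 + R * u\<^sup>2 = 1" and t0: "t \<noteq> 0"
begin

text \<open>Since \<open>D t = N * u\<close>, this is the Wronskian of \<open>t\<close> and
  \<open>y\<close>.\<close>

definition W where "W y = t * D y - N * u * y"

lemma DR: "D R = - 2 * X"
  unfolding R by (simp add: derivation_diff[OF der] derivation_1[OF der] derivation_power2[OF der] DX)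

text \<open>Abel's identity for the Chebyshev equation.\<close>

lemma D_W:
  assumes "R * D (D y) = X * D y - N\<^sup>2 * y"
  shows "R * D (W y) = X * W y"
proof -
  have "D (W y) = t * D (D y) - N * D u * y"
    unfolding W_def by (simp add: derivation_diff[OF der] derivation_mult[OF der] Dt DN algebra_simps)
  then show ?thesis using assms Du unfolding W_def by algebra
qed

lemma D_quotient: "D (y / t) = W y / t\<^sup>2"
  by (simp add: derivation_divide[OF der t0] Dt W_def algebra_simps)

text \<open>By Abel's identity W^2 contributes 2 X W^2 to the derivative, and
  \<open>D R = - 2 * X\<close> cancels it. The resulting constant is what later yields a square root
  of R inside L.\<close>

lemma W_square_const:
  assumes "R * D (D y) = X * D y - N\<^sup>2 * y"
  shows "D ((W y)\<^sup>2 * R) = 0"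
proof -
  have "D ((W y)\<^sup>2 * R) = 2 * W y * (R * D (W y)) - 2 * X * (W y)\<^sup>2"
    by (simp add: derivation_mult[OF der] derivation_power2[OF der] DR algebra_simps)
  then show ?thesis by (simp add: D_W[OF assms] power2_eq_square)
qed

text \<open>The second solution is \<open>s * u\<close>, whose Wronskian with \<open>t\<close> is \<open>- N * s / R\<close>.\<close>

lemma solution_decomposition:
  assumes ode: "R * D (D y) = X * D y - N\<^sup>2 * y" and s: "s\<^sup>2 = R" and two: "(2 :: 'l) \<noteq> 0"
  shows "\<exists>c k. D c = 0 \<and> D k = 0 \<and> y = c * t - k / N * s * u"
proof -
  have s0: "s \<noteq> 0" using s R0 by auto
  have "2 * s * D s = - 2 * X" by (simp flip: derivation_power2[OF der] add: s DR)
  then have "2 * (s * D s + X) = 0" by (simp add: algebra_simps)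
  with two have "s * D s + X = 0" by (metis mult_eq_0_iff)
  then have sDs: "s * D s = - X" by (simp add: eq_neg_iff_add_eq_0)
  then have Ds: "R * D s = - X * s" unfolding s[symmetric] by algebra
  \<comment> \<open>The logarithmic derivatives of W and \<open>s\<close> are X / R and - X / R, so
    their product is constant.\<close>
  define k where "k = W y * s"
  have "R * D k = R * D (W y) * s + W y * (R * D s)"
    by (simp add: k_def derivation_mult[OF der] algebra_simps)
  also have "\<dots> = 0" by (simp add: D_W[OF ode] Ds)
  finally have Dk: "D k = 0" using R0 by simp
  \<comment> \<open>Reduction of order: after division by \<open>t\<close>, the derivative of y / t
    is cancelled by that of the multiple of s u / t.\<close>
  define c where "c = y / t + k / N * (s * u / t)"
  have "R * D (k / N * (s * u / t)) = - (k * s) / t\<^sup>2"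
  proof -
    have kN: "D (k / N) = 0" by (simp add: derivation_divide[OF der N0] Dk DN)
    have "D (k / N * (s * u / t)) = k / N * D (s * u / t)"
      by (simp only: derivation_mult[OF der] kN mult_zero_left add_0)
    also have "\<dots> = k / N * ((D s * u + s * D u) * t - s * u * (N * u)) / t\<^sup>2"
      by (simp add: derivation_divide[OF der t0] derivation_mult[OF der] Dt)
    finally have "R * D (k / N * (s * u / t))
        = k / N * (((R * D s) * u + s * (R * D u)) * t - R * s * u * (N * u)) / t\<^sup>2"
      by (simp add: algebra_simps)
    also have "((R * D s) * u + s * (R * D u)) * t - R * s * u * (N * u) = - N * s * (t\<^sup>2 + R * u\<^sup>2)"
      unfolding Ds Du by (simp add: algebra_simps power2_eq_square)
    finally show ?thesis using N0 by (simp add: pell)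
  qed
  moreover have "R * D (y / t) = k * s / t\<^sup>2"
    by (simp add: D_quotient k_def s[symmetric] power2_eq_square algebra_simps)
  ultimately have "R * D c = 0"
    unfolding c_def by (simp add: derivation_add[OF der] distrib_left)
  then have Dc: "D c = 0" using R0 by simp
  have "y = c * t - k / N * s * u"
    using t0 by (simp add: c_def field_simps)
  with Dc Dk show ?thesis by blast
qed

end

section \<open>The Galois group of the Chebyshev equation\<close>

lemma diff_galois_group_cheb:
  fixes D :: "'l::field \<Rightarrow> 'l" and \<iota> :: "complex poly fract \<Rightarrow> 'l"
  assumes lam: "lam = (of_nat (Suc m))\<^sup>2"
    and PV: "picard_vessiot fract_deriv D \<iota>
      (- Fract [:0, 1:] [:1, 0, -1:]) (Fract [:lam:] [:1, 0, -1:])"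
  shows "diff_galois_group D \<iota> \<cong> integer_mod_group 2"
proof -
  have ext: "diff_field_ext fract_deriv D \<iota>" and cst: "consts_of D = \<iota> ` consts_of fract_deriv"
    using PV by (auto simp: picard_vessiot_def)
  have der: "is_derivation D" and hom: "is_field_hom \<iota>" and comm: "D (\<iota> a) = \<iota> (fract_deriv a)" for a
    using ext by (auto simp: diff_field_ext_def)
  define e where "e p = \<iota> (Fract p 1)" for p
  have e_add: "e (p + q) = e p + e q" and e_mult: "e (p * q) = e p * e q"
    and e_diff: "e (p - q) = e p - e q" and e_1: "e 1 = 1" for p q
    by (simp_all add: e_def One_fract_def[symmetric] field_hom_1[OF hom]
        flip: field_hom_add[OF hom] field_hom_mult[OF hom] field_hom_diff[OF hom])
  have e_power2: "e (p\<^sup>2) = (e p)\<^sup>2" for p by (simp add: power2_eq_square e_mult)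
  have e_eq_0: "e p = 0 \<longleftrightarrow> p = 0" for p
    by (simp add: e_def field_hom_eq_0_iff[OF hom] Zero_fract_def eq_fract)
  have De: "D (e p) = e (pderiv p)" for p
    by (simp add: e_def comm fract_deriv_Fract)
  have e_Fract: "\<iota> (Fract p q) = e p / e q" if "q \<noteq> 0" for p q
    by (simp add: e_def flip: field_hom_divide[OF hom])
  let ?n = "of_nat (Suc m) :: complex"
  define X where "X = e [:0, 1:]"
  define R where "R = e [:1, 0, -1:]"
  define t where "t = e (cheb_T (Suc m))"
  define u where "u = e (cheb_U m)"
  define N where "N = e [:?n:]"
  interpret cheb_ext D X R t u N
  proof
    show "is_derivation D" by (rule der)
    show "D X = 1" by (simp add: X_def De pderiv_pCons flip: e_1 one_pCons)
    have "[:1, 0, -1:] = 1 - [:0, 1 :: complex:]\<^sup>2" by (simp add: power2_eq_square one_pCons)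
    then show "R = 1 - X\<^sup>2" by (simp only: R_def X_def e_diff e_1 e_power2)
    show "R \<noteq> 0" by (simp add: R_def e_eq_0)
    show "D N = 0" by (simp add: N_def De e_eq_0)
    show "N \<noteq> 0" by (simp add: N_def e_eq_0 del: of_nat_Suc)
    show "D t = N * u" by (simp add: t_def N_def u_def De pderiv_cheb_T flip: e_mult)
    have "smult ?n (cheb_T (Suc m)) = [:?n:] * cheb_T (Suc m)" by simp
    then show "R * D u = X * u - N * t"
      by (simp only: R_def X_def t_def N_def u_def De pderiv_cheb_U flip: e_mult e_diff)
    show "t\<^sup>2 + R * u\<^sup>2 = 1"
      by (simp only: R_def t_def u_def cheb_pell e_1 flip: e_mult e_power2 e_add)
    show "t \<noteq> 0" by (simp add: t_def e_eq_0 cheb_T_nonzero)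
  qed
  have two: "(2 :: 'l) \<noteq> 0"
    using e_eq_0[of "[:2:]"] e_add[of 1 1] by (simp add: e_1 one_pCons)
  have range_const: "c \<in> range \<iota>" if "D c = 0" for c
  proof -
    have "c \<in> consts_of D" using that by (simp add: consts_of_def)
    then show ?thesis unfolding cst by blast
  qed
  from PV obtain y1 y2 where
    sol: "\<forall>y\<in>{y1, y2}.
        D (D y) + \<iota> (- Fract [:0, 1:] [:1, 0, -1:]) * D y + \<iota> (Fract [:lam:] [:1, 0, -1:]) * y = 0"
    and indep: "\<forall>c1\<in>consts_of D. \<forall>c2\<in>consts_of D. c1 * y1 + c2 * y2 = 0 \<longrightarrow> c1 = 0 \<and> c2 = 0"
    and gen: "\<forall>F. diff_subfield D F \<and> range \<iota> \<subseteq> F \<and> {y1, y2} \<subseteq> F \<longrightarrow> F = UNIV"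
    unfolding picard_vessiot_def by (elim conjE exE) (rule that)
  have ode: "R * D (D y) = X * D y - N\<^sup>2 * y" if "y \<in> {y1, y2}" for y
  proof -
    have "[:lam:] = [:?n:]\<^sup>2" by (simp add: lam power2_eq_square)
    then have "e [:lam:] = N\<^sup>2" by (simp only: e_power2 N_def)
    then have "D (D y) - X / R * D y + N\<^sup>2 / R * y = 0"
      using bspec[OF sol that] by (simp add: field_hom_minus[OF hom] e_Fract X_def R_def del: minus_fract)
    then show ?thesis using R0 by (simp add: field_simps)
  qed
  \<comment> \<open>If both Wronskians vanished, y1 / t and y2 / t would be constants, and (y2 / t)
    y1 - (y1 / t) y2 = 0 would contradict independence.\<close>
  have "\<exists>y\<in>{y1, y2}. W y \<noteq> 0"
  proof (rule ccontr)
    assume "\<not> ?thesis"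
    then have "D (y1 / t) = 0" "D (y2 / t) = 0" by (auto simp: D_quotient)
    then have c: "D (y2 / t) = 0" "D (- (y1 / t)) = 0" by (simp_all add: derivation_minus[OF der])
    have "y2 / t * y1 + - (y1 / t) * y2 = 0" by simp
    with indep c have "y2 / t = 0 \<and> - (y1 / t) = 0" unfolding consts_of_def by blast
    then have "1 * y1 + 0 * y2 = 0" using t0 by simp
    moreover have "1 \<in> consts_of D" "0 \<in> consts_of D"
      by (simp_all add: consts_of_def derivation_0[OF der] derivation_1[OF der])
    ultimately show False using indep by (metis one_neq_zero)
  qed
  then obtain y0 where y0: "y0 \<in> {y1, y2}" "W y0 \<noteq> 0" by blast
  have "D ((W y0)\<^sup>2 * R) = 0" by (rule W_square_const[OF ode[OF y0(1)]])
  \<comment> \<open>As there are no new constants, this constant comes from a complex number, whose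
    square root lies in K.\<close>
  then obtain f where f: "f \<in> consts_of fract_deriv" "(W y0)\<^sup>2 * R = \<iota> f"
    using cst by (auto simp: consts_of_def)
  obtain c where "f = Fract [:c:] 1" using consts_of_fract_deriv[OF f(1)] by blast
  with f(2) have c: "(W y0)\<^sup>2 * R = e [:c:]" by (simp add: e_def)
  define \<gamma> where "\<gamma> = e [:csqrt c:]"
  have "[:c:] = [:csqrt c:]\<^sup>2" using power2_csqrt[of c] by (simp add: power2_eq_square)
  then have \<gamma>: "(W y0)\<^sup>2 * R = \<gamma>\<^sup>2" unfolding c \<gamma>_def by (simp only: e_power2)
  then have \<gamma>0: "\<gamma> \<noteq> 0" using y0(2) R0 by auto
  \<comment> \<open>From W^2 R = \<gamma>^2 the square of W R / \<gamma> is R.\<close>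
  define s where "s = W y0 * R / \<gamma>"
  have "s\<^sup>2 * \<gamma>\<^sup>2 = (W y0)\<^sup>2 * R * R" using \<gamma>0 by (simp add: s_def power2_eq_square)
  then have s: "s\<^sup>2 = R" using \<gamma>0 by (simp add: \<gamma>)
  interpret quadratic_diff_ext fract_deriv D \<iota> s "Fract [:1, 0, -1:] 1"
  proof
    show "s\<^sup>2 = \<iota> (Fract [:1, 0, -1:] 1)" using s by (simp add: R_def e_def)
    then show "s \<notin> range \<iota>"
      using not_square_in_fract by (auto simp: field_hom_eq_iff[OF hom] simp flip: field_hom_power2[OF hom])
  qed (rule ext two)+
  let ?F = "{\<iota> a + \<iota> b * s |a b. True}"
  have "?F = UNIV"
  proof (rule gen[rule_format], intro conjI diff_subfield_basis)
    show "range \<iota> \<subseteq> ?F"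
    proof safe
      fix a
      have "\<iota> a = \<iota> a + \<iota> 0 * s" by (simp add: field_hom_0[OF hom])
      then show "\<exists>a' b. \<iota> a = \<iota> a' + \<iota> b * s \<and> True" by blast
    qed
    \<comment> \<open>The coefficients in \<open>solution_decomposition\<close> are constants and
      hence lie in K, so every generator is in K + K s.\<close>
    have "y \<in> ?F" if y: "y \<in> {y1, y2}" for y
    proof -
      obtain c k where ck: "D c = 0" "D k = 0" "y = c * t - k / N * s * u"
        using solution_decomposition[OF ode[OF y] s two] by blast
      obtain c' k' where "c = \<iota> c'" "k = \<iota> k'" using ck range_const by blast
      then have "y = \<iota> (c' * Fract (cheb_T (Suc m)) 1) + \<iota> (- (k' / Fract [:?n:] 1 * Fract (cheb_U m) 1)) * s"
        unfolding ck(3) t_def u_def N_def e_def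
        by (simp only: field_hom_mult[OF hom] field_hom_divide[OF hom] field_hom_minus[OF hom]) simp
      then show ?thesis by blast
    qed
    then show "{y1, y2} \<subseteq> ?F" by blast
  qed
  then show ?thesis by (intro diff_galois_group_iso) blast
qed

theorem proposition2p7:
  fixes n :: nat and lam \<mu> :: complex
  assumes "n \<ge> 1" and "lam = (of_nat n)\<^sup>2" and "\<mu> \<noteq> 0"
  shows "(\<forall>(D :: 'l::field \<Rightarrow> 'l) (\<iota> :: complex poly fract \<Rightarrow> 'l).
            picard_vessiot fract_deriv D \<iota>
              (- Fract [:0, 1:] [:1, 0, -1:]) (Fract [:lam:] [:1, 0, -1:]) \<longrightarrow>
            diff_galois_group D \<iota> \<cong> integer_mod_group 2) \<and>
         (\<forall>S s. sqrt_branch S s \<longrightarrow>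
            first_integral_on
              (\<lambda>(w, x). (- 2 - 4 * lam + (4 * lam - 1) * x\<^sup>2 - 4 * (1 - x\<^sup>2)\<^sup>2 * w\<^sup>2,
                         4 * (1 - x\<^sup>2)\<^sup>2))
              (\<lambda>(w, x).
                 (- w + poly (pderiv (cheb_U (n - 1))) x / poly (cheb_U (n - 1)) x
                      - 3 * x / (2 * (1 - x\<^sup>2)))
                 / (- w + poly (pderiv (cheb_T n)) x / poly (cheb_T n) x
                      - x / (2 * (1 - x\<^sup>2)))
                 * (poly (cheb_U (n - 1)) x / poly (cheb_T n) x) * s x)
              {(w, x). x \<in> S \<and> 1 - x\<^sup>2 \<noteq> 0 \<and>
                 poly (cheb_U (n - 1)) x \<noteq> 0 \<and> poly (cheb_T n) x \<noteq> 0 \<and>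
                 - w + poly (pderiv (cheb_T n)) x / poly (cheb_T n) x
                     - x / (2 * (1 - x\<^sup>2)) \<noteq> 0}) \<and>
         (\<forall>S s. sqrt_branch S s \<longrightarrow>
            first_integral_on
              (\<lambda>(v, x). (lam / \<mu> * (1 - x\<^sup>2) - x * v + \<mu> * v\<^sup>2, 1 - x\<^sup>2))
              (\<lambda>(v, x).
                 (poly (pderiv (cheb_U (n - 1))) x * (1 - x\<^sup>2)
                    + poly (cheb_U (n - 1)) x * (\<mu> * v - x))
                 / (poly (pderiv (cheb_T n)) x * (1 - x\<^sup>2) + \<mu> * poly (cheb_T n) x * v)
                 * s x)
              {(v, x). x \<in> S \<and>
                 poly (pderiv (cheb_T n)) x * (1 - x\<^sup>2) + \<mu> * poly (cheb_T n) x * v \<noteq> 0})"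
proof -
  obtain m where m: "n = Suc m" using assms(1) by (cases n) auto
  then have nm: "n - 1 = m" by simp
  have lam: "lam = (of_nat (Suc m))\<^sup>2" using assms(2) m by simp
  show ?thesis
    unfolding nm unfolding m
    by (intro conjI allI impI diff_galois_group_cheb[OF lam]
        cheb_branch.first_integral_w[OF cheb_branch.intro lam]
        cheb_branch.first_integral_v[OF cheb_branch.intro assms(3) lam])
qed

end
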